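(* Let $m$ and $k$ be integers such that either $k=2$ and $m\ge 2$ is even, or $k=4$ and $m\ge 6$ is even but not a multiple of $4$. Then $S_{m,k}(A,B)$ is cyclically equivalent to a sum of Hermitian squares in $\mathbf{R}\langle A,B\rangle$. Therefore, for these values of $m$ and $k$, $\mathrm{Tr}(S_{m,k}(A,B))\ge 0$ whenever $A$ and $B$ are Hermitian matrices (of the same size).
   Context: $\mathbf{R}\langle A,B\rangle$ is the algebra of real polynomials in noncommuting variables $A$ and $B$, endowed with the linear, anti-multiplicative involution $*$ such that $A^*=A$ and $B^*=B$. $S_{m,k}(A,B)$ denotes the sum of all words of length $m$ in $A$ and $B$ having exactly $k$ letters equal to $B$ and $m-k$ letters equal to $A$; it may also be evaluated at matrices $A$, $B$. A Hermitian square is an element of the form $f^*f$ with $f\in\mathbf{R}\langle A,B\rangle$; sums are finite. Two elements $f,g\in\mathbf{R}\langle A,B\rangle$ are cyclically equivalent if $f-g$ is a finite sum of commutators $[a,b]=ab-ba$ of elements of $\mathbf{R}\langle A,B\rangle$. Matrices are square complex matrices and $\mathrm{Tr}$ is the usual trace. *)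

theory Defs
  imports "HOL-Analysis.Analysis" "HOL-Library.Poly_Mapping" "HOL-Library.Complex_Order"
begin

text \<open>
  The free algebra on two letters is the monoid algebra of the free monoid, obtained from the
  convolution product of \<^theory>\<open>HOL-Library.Poly_Mapping\<close>. That product expects an additively written
  (not necessarily commutative) monoid, so concatenation of words is written as addition and the
  empty word as zero.
\<close>

datatype letter = LA | LB

datatype word = Word (letters: "letter list")

instantiation word :: monoid_add
begin

definition "0 = Word []"

definition "v + w = Word (letters v @ letters w)"

instance
  by standard (auto simp: zero_word_def plus_word_def)

end

type_synonym nc_poly = "word \<Rightarrow>\<^sub>0 real"

definition nc_A :: nc_poly
  where "nc_A = Poly_Mapping.single (Word [LA]) 1"

definition nc_B :: nc_poly
  where "nc_B = Poly_Mapping.single (Word [LB]) 1"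

fun rev_word :: "word \<Rightarrow> word"
  where "rev_word (Word xs) = Word (rev xs)"

definition nc_star :: "nc_poly \<Rightarrow> nc_poly"
  where "nc_star f =
    (\<Sum>w\<in>Poly_Mapping.keys f. Poly_Mapping.single (rev_word w) (Poly_Mapping.lookup f w))"

definition S_poly :: "nat \<Rightarrow> nat \<Rightarrow> nc_poly"
  where "S_poly m k =
    (\<Sum>w | length (letters w) = m \<and> count_list (letters w) LB = k. Poly_Mapping.single w 1)"

definition sum_of_hermitian_squares :: "nc_poly \<Rightarrow> bool"
  where "sum_of_hermitian_squares g \<longleftrightarrow> (\<exists>fs. g = (\<Sum>f\<leftarrow>fs. nc_star f * f))"

definition cyclically_equivalent :: "nc_poly \<Rightarrow> nc_poly \<Rightarrow> bool"
  where "cyclically_equivalent f g \<longleftrightarrow> (\<exists>ps. f - g = (\<Sum>(a, b)\<leftarrow>ps. a * b - b * a))"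

text \<open>
  On matrices the class multiplication and power are entrywise, hence the explicit matrix product.
\<close>

primrec word_eval :: "complex^'n^'n \<Rightarrow> complex^'n^'n \<Rightarrow> letter list \<Rightarrow> complex^'n^'n"
  where
    "word_eval A B [] = mat 1"
  | "word_eval A B (x # xs) = (case x of LA \<Rightarrow> A | LB \<Rightarrow> B) ** word_eval A B xs"

definition nc_eval :: "complex^'n^'n \<Rightarrow> complex^'n^'n \<Rightarrow> nc_poly \<Rightarrow> complex^'n^'n"
  where "nc_eval A B f =
    (\<Sum>w\<in>Poly_Mapping.keys f. Poly_Mapping.lookup f w *\<^sub>R word_eval A B (letters w))"

definition hermitian_matrix :: "complex^'n^'n \<Rightarrow> bool"
  where "hermitian_matrix A \<longleftrightarrow> (\<chi> i j. cnj (A $ j $ i)) = A"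


text \<open>The index set of the sum defining \<^const>\<open>S_poly\<close> is finite, so that sum is not vacuous.\<close>

lemma finite_words_length: "finite {w. length (letters w) = m \<and> P w}"
proof -
  have "UNIV = {LA, LB}"
    using letter.exhaust by auto
  then have "finite (UNIV :: letter set)"
    by (metis finite.emptyI finite.insertI)
  then have "finite {xs :: letter list. length xs = m}"
    using finite_lists_length_eq[of "UNIV :: letter set" m] by simp
  then have "finite (Word ` {xs. length xs = m})"
    by simp
  moreover have "{w. length (letters w) = m \<and> P w} \<subseteq> Word ` {xs. length xs = m}"
  proof
    fix w assume "w \<in> {w. length (letters w) = m \<and> P w}"
    then show "w \<in> Word ` {xs. length xs = m}"
      by (cases w) auto
  qed
  ultimately show ?thesis
    by (rule finite_subset[rotated])
qed


text \<open>
  \<^const>\<open>nc_star\<close> is the linear, anti-multiplicative involution that fixes both generators.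
\<close>

lemma rev_word_rev_word [simp]: "rev_word (rev_word w) = w"
  by (cases w) simp

lemma rev_word_plus: "rev_word (v + w) = rev_word w + rev_word v"
  by (cases v; cases w) (simp add: plus_word_def)

lemma lookup_nc_star: "Poly_Mapping.lookup (nc_star f) w = Poly_Mapping.lookup f (rev_word w)"
proof -
  have "Poly_Mapping.lookup (nc_star f) w =
      (\<Sum>v\<in>Poly_Mapping.keys f. if v = rev_word w then Poly_Mapping.lookup f v else 0)"
    unfolding nc_star_def lookup_sum
    by (rule sum.cong) (auto simp: lookup_single when_def)
  also have "\<dots> = Poly_Mapping.lookup f (rev_word w)"
    by (simp add: in_keys_iff)
  finally show ?thesis .
qed

lemma nc_star_nc_star: "nc_star (nc_star f) = f"
  by (rule poly_mapping_eqI) (simp add: lookup_nc_star)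

lemma nc_star_add: "nc_star (f + g) = nc_star f + nc_star g"
  by (rule poly_mapping_eqI) (simp add: lookup_nc_star lookup_add)

lemma nc_star_single: "nc_star (Poly_Mapping.single w c) = Poly_Mapping.single (rev_word w) c"
  by (simp add: nc_star_def)

lemma nc_star_nc_A: "nc_star nc_A = nc_A"
  and nc_star_nc_B: "nc_star nc_B = nc_B"
  by (simp_all add: nc_A_def nc_B_def nc_star_single)

lemma nc_poly_expand:
  "(f :: nc_poly) = (\<Sum>w\<in>Poly_Mapping.keys f. Poly_Mapping.single w (Poly_Mapping.lookup f w))"
  by (rule poly_mapping_eqI) (simp add: lookup_sum lookup_single when_def in_keys_iff)

lemma nc_star_sum: "nc_star (sum h I) = (\<Sum>i\<in>I. nc_star (h i))"
  by (rule poly_mapping_eqI) (simp add: lookup_nc_star lookup_sum)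

lemma nc_star_mult: "nc_star (f * g) = nc_star g * nc_star f"
proof -
  have "nc_star (f * g) = nc_star (
      (\<Sum>v\<in>Poly_Mapping.keys f. Poly_Mapping.single v (Poly_Mapping.lookup f v)) *
      (\<Sum>w\<in>Poly_Mapping.keys g. Poly_Mapping.single w (Poly_Mapping.lookup g w)))"
    by (simp flip: nc_poly_expand)
  also have "\<dots> = (\<Sum>v\<in>Poly_Mapping.keys f. \<Sum>w\<in>Poly_Mapping.keys g.
      Poly_Mapping.single (rev_word w) (Poly_Mapping.lookup g w) *
      Poly_Mapping.single (rev_word v) (Poly_Mapping.lookup f v))"
    by (simp add: sum_product nc_star_sum mult_single nc_star_single rev_word_plus mult.commute)
  also have "\<dots> = nc_star g * nc_star f"
    unfolding nc_star_def sum_product by (rule sum.swap)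
  finally show ?thesis .
qed

end

theory Submission
  imports Defs
begin

text \<open>
  Up to cyclic equivalence a word with \<open>k\<close> letters \<open>B\<close> may be rotated so that it starts with \<open>B\<close>, and
  is then given by its gaps, the exponents of \<open>A\<close> between consecutive letters \<open>B\<close>. Hence \<open>S\<^sub>m\<^sub>,\<^sub>k\<close> is
  cyclically equivalent to \<open>m / k\<close> times the sum of the necklaces of all gap lists of length \<open>k\<close> and sum
  \<open>m - k\<close> (lemma \<open>S_poly_cyc_eq_necklaces\<close>). It remains to write the sum of all necklaces, up to
  rotation of the gap lists, as a sum of squares. In both cases the total gap is an even number \<open>2 p\<close>.

  For \<open>k = 2\<close>, let \<open>v\<^sub>j\<close> be the word \<open>A ^ j B A ^ (p - j)\<close>. Then \<open>v\<^sub>i\<^sup>* v\<^sub>j\<close> has the gaps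
  \<open>[i + j, 2 p - i - j]\<close>, so that only \<open>i + j\<close> matters and the claim is the polynomial identity
  \<open>1 + x ^ (2 p) + (\<Sum>j<p. (x ^ j + x ^ (j + 1))\<^sup>2) = (\<Sum>a\<le>2 p. 2 x ^ a)\<close>.

  For \<open>k = 4\<close>, the square of a combination of words \<open>A ^ i B A ^ j B A ^ l\<close> with \<open>i + j + l = p\<close> contributes
  the gaps \<open>[j, i + i', j', l + l']\<close>. Two observations make such squares produce all necklaces.

  First, it is enough to produce a part of them. Rotating \<open>[a, b, c, d]\<close> by one place turns the pair
  \<open>(a + b - p, b + c - p)\<close> into \<open>(b + c - p, p - a - b)\<close>, a quarter turn of the plane. So if neither entry is
  \<open>0\<close>, exactly one of the four rotations has two negative entries, and it is enough to produce this one.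
  If exactly one entry is \<open>0\<close>, two rotations have the signs \<open>(0, -)\<close> and \<open>(-, 0)\<close> and each is produced with half the
  weight. If both are \<open>0\<close>, the list is \<open>[p - b, b, p - b, b]\<close>, and rotation exchanges \<open>b\<close> and \<open>p - b\<close>.
  As \<open>m\<close> is not a multiple of \<open>4\<close>, the number \<open>p\<close> is odd, so that exactly one of them is even, and it is
  enough to produce the lists with \<open>b\<close> even (lemma \<open>weight_rotations\<close>).

  Second, these lists come from a positive semidefinite Gram matrix. Put \<open>a = p - k\<close> and \<open>c = p - k'\<close> and
  record \<open>b\<close> as the exponent of a variable \<open>x\<close>. The conditions \<open>a + b < p\<close> and \<open>b + c < p\<close> say
  \<open>b < min k k'\<close>, so the entry of the matrix at \<open>k, k'\<close> is \<open>(\<Sum>b<min k k'. 2 x ^ b) + x ^ min k k'\<close>, except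
  that the last term is absent if \<open>k = k'\<close> is odd. With \<open>\<phi>\<^sub>r(k) = [2 r + 1 \<le> k] + x [2 r + 2 \<le> k]\<close>, this
  entry equals \<open>1 + (\<Sum>r. x ^ (2 r) \<phi>\<^sub>r(k) \<phi>\<^sub>r(k'))\<close> (lemma \<open>gram_entry_sum\<close>), a sum of rank one matrices
  which are squares. The missing odd diagonal terms are exactly what makes this decomposition work.

  Finally, evaluation at Hermitian matrices respects products and adjoints, the trace vanishes on
  commutators, and the trace of \<open>X\<^sup>* X\<close> is nonnegative.
\<close>

section \<open>Cyclic equivalence\<close>

abbreviation cyc_eq :: "nc_poly \<Rightarrow> nc_poly \<Rightarrow> bool"  (infix "\<simeq>" 50)
  where "f \<simeq> g \<equiv> cyclically_equivalent f g"

abbreviation word_term :: "letter list \<Rightarrow> real \<Rightarrow> nc_poly"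
  where "word_term xs r \<equiv> Poly_Mapping.single (Word xs) r"

lemma cyc_eq_refl [simp]: "f \<simeq> f"
  unfolding cyclically_equivalent_def by (rule exI[of _ "[]"]) simp

lemma cyc_eq_add:
  assumes "f \<simeq> g" and "f' \<simeq> g'"
  shows "f + f' \<simeq> g + g'"
proof -
  obtain ps where ps: "f - g = (\<Sum>(a, b)\<leftarrow>ps. a * b - b * a)"
    using assms(1) unfolding cyclically_equivalent_def by blast
  obtain qs where qs: "f' - g' = (\<Sum>(a, b)\<leftarrow>qs. a * b - b * a)"
    using assms(2) unfolding cyclically_equivalent_def by blast
  have "f + f' - (g + g') = (\<Sum>(a, b)\<leftarrow>ps @ qs. a * b - b * a)"
    by (simp flip: ps qs)
  then show ?thesis
    unfolding cyclically_equivalent_def by blast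
qed

lemma cyc_eq_trans [trans]:
  assumes "f \<simeq> g" and "g \<simeq> h"
  shows "f \<simeq> h"
proof -
  have "f + g \<simeq> g + h"
    using assms by (rule cyc_eq_add)
  then show ?thesis
    by (simp add: cyclically_equivalent_def algebra_simps)
qed

lemma cyc_eq_sym:
  assumes "f \<simeq> g"
  shows "g \<simeq> f"
proof -
  obtain ps where ps: "f - g = (\<Sum>(a, b)\<leftarrow>ps. a * b - b * a)"
    using assms unfolding cyclically_equivalent_def by blast
  have "(\<Sum>(a, b)\<leftarrow>map prod.swap ps. a * b - b * a) = - (\<Sum>(a, b)\<leftarrow>ps. a * b - b * a)"
    by (induction ps) auto
  then have "g - f = (\<Sum>(a, b)\<leftarrow>map prod.swap ps. a * b - b * a)"
    by (simp flip: ps)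
  then show ?thesis
    unfolding cyclically_equivalent_def by blast
qed

lemma cyc_eq_sum:
  assumes "\<And>x. x \<in> X \<Longrightarrow> f x \<simeq> g x"
  shows "sum f X \<simeq> sum g X"
  using assms by (induction X rule: infinite_finite_induct) (auto intro: cyc_eq_add)

lemma word_term_mult: "word_term xs r * word_term ys s = word_term (xs @ ys) (r * s)"
  by (simp add: mult_single plus_word_def)

lemma cyc_eq_append_swap: "word_term (xs @ ys) r \<simeq> word_term (ys @ xs) r"
  unfolding cyclically_equivalent_def
  by (rule exI[of _ "[(word_term xs r, word_term ys 1)]"]) (simp add: word_term_mult)

lemma cyc_eq_rotate: "word_term xs r \<simeq> word_term (rotate i xs) r"
  by (metis append_take_drop_id cyc_eq_append_swap rotate_drop_take)

text \<open>
  Rotation permutes a finite set of lists that it maps into itself. This turns a sum over positions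
  in a word into a sum over words.
\<close>

lemma sum_rotate:
  assumes "finite X" and "\<And>xs. xs \<in> X \<Longrightarrow> rotate1 xs \<in> X"
  shows "(\<Sum>xs\<in>X. G (rotate i xs)) = (\<Sum>xs\<in>X. G xs)"
proof -
  have inj: "inj_on (rotate i) X"
    unfolding rotate_def by (rule inj_on_subset[OF inj_fn[OF inj_rotate1]]) simp
  have "rotate i xs \<in> X" if "xs \<in> X" for xs
    using that by (induction i) (auto simp: assms(2))
  then have "rotate i ` X = X"
    using endo_inj_surj[OF assms(1) _ inj] by blast
  then show ?thesis
    using sum.reindex[OF inj, of G] by (simp add: comp_def)
qed

section \<open>Words as necklaces of gaps\<close>

text \<open>
  The exponents of the powers of \<open>A\<close> that follow the letters \<open>B\<close> describe a word that starts with
  \<open>B\<close>. Rotating this list of gaps rotates the word by whole blocks, so it does not change the cyclic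
  equivalence class.
\<close>

definition gap_word :: "nat list \<Rightarrow> letter list"
  where "gap_word gs = concat (map (\<lambda>g. LB # replicate g LA) gs)"

abbreviation necklace :: "nat list \<Rightarrow> real \<Rightarrow> nc_poly"
  where "necklace gs r \<equiv> word_term (gap_word gs) r"

definition compositions :: "nat \<Rightarrow> nat \<Rightarrow> nat list set"
  where "compositions k N = {gs. length gs = k \<and> sum_list gs = N}"

lemma finite_compositions: "finite (compositions k N)"
proof (rule finite_subset)
  show "compositions k N \<subseteq> {gs. set gs \<subseteq> {..N} \<and> length gs = k}"
    unfolding compositions_def using member_le_sum_list by fastforce
  show "finite {gs. set gs \<subseteq> {..N} \<and> length gs = k}"
    by (rule finite_lists_length_eq) simp
qed

lemma gap_word_simps [simp]:
  "gap_word [] = []"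
  "gap_word (g # gs) = LB # replicate g LA @ gap_word gs"
  by (simp_all add: gap_word_def)

lemma length_gap_word: "length (gap_word gs) = length gs + sum_list gs"
  by (induction gs) auto

lemma count_replicate: "count_list (replicate n x) y = (if x = y then n else 0)"
  by (induction n) auto

lemma count_gap_word: "count_list (gap_word gs) LB = length gs"
  by (induction gs) (auto simp: count_replicate)

lemma hd_gap_word: "gap_word gs = [] \<or> hd (gap_word gs) = LB"
  by (cases gs) auto

lemma gap_word_append: "gap_word (gs @ hs) = gap_word gs @ gap_word hs"
  by (simp add: gap_word_def)

lemma necklace_rotate: "necklace gs r \<simeq> necklace (rotate i gs) r"
  by (metis append_take_drop_id cyc_eq_append_swap gap_word_append rotate_drop_take)

lemma takeWhile_gap_word: "takeWhile (\<lambda>x. x = LA) (replicate g LA @ gap_word gs) = replicate g LA"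
proof -
  have "takeWhile (\<lambda>x. x = LA) (gap_word gs) = []"
    by (cases gs) auto
  then show ?thesis
    by (induction g) auto
qed

lemma inj_gap_word: "gap_word gs = gap_word hs \<Longrightarrow> gs = hs"
proof (induction gs arbitrary: hs)
  case Nil
  then show ?case
    by (cases hs) auto
next
  case (Cons g gs)
  then obtain h hs' where hs: "hs = h # hs'"
    by (cases hs) auto
  have eq: "replicate g LA @ gap_word gs = replicate h LA @ gap_word hs'"
    using Cons.prems by (simp add: hs)
  then have "replicate g LA = replicate h LA"
    using takeWhile_gap_word by metis
  then have "g = h"
    using length_replicate by metis
  with eq Cons.IH[of hs'] show ?case
    by (simp add: hs)
qed

lemma gap_word_surj: "xs = [] \<or> hd xs = LB \<Longrightarrow> \<exists>gs. xs = gap_word gs"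
proof (induction xs rule: length_induct)
  case (1 xs)
  show ?case
  proof (cases xs)
    case Nil
    then have "xs = gap_word []"
      by simp
    then show ?thesis ..
  next
    case (Cons x ys)
    let ?P = "\<lambda>x. x = LA"
    have x: "x = LB"
      using "1.prems" Cons by simp
    have "dropWhile ?P ys = [] \<or> hd (dropWhile ?P ys) = LB"
      using hd_dropWhile[of ?P ys] letter.exhaust by metis
    moreover have "length (dropWhile ?P ys) < length xs"
      using Cons length_dropWhile_le[of ?P ys] by simp
    ultimately obtain gs where gs: "dropWhile ?P ys = gap_word gs"
      using "1.IH" by blast
    have "replicate (length (takeWhile ?P ys)) LA = takeWhile ?P ys"
      by (rule replicate_length_same) (auto dest: set_takeWhileD)
    then have "xs = gap_word (length (takeWhile ?P ys) # gs)"
      using gs x Cons takeWhile_dropWhile_id[of ?P ys] by simp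
    then show ?thesis ..
  qed
qed

lemma bij_gap_word:
  assumes "0 < k" and "k \<le> m"
  shows "bij_betw gap_word (compositions k (m - k))
    {xs. length xs = m \<and> count_list xs LB = k \<and> hd xs = LB}"
proof (rule bij_betwI')
  fix gs hs
  show "gap_word gs = gap_word hs \<longleftrightarrow> gs = hs"
    using inj_gap_word by blast
next
  fix gs assume "gs \<in> compositions k (m - k)"
  then show "gap_word gs \<in> {xs. length xs = m \<and> count_list xs LB = k \<and> hd xs = LB}"
    using assms hd_gap_word[of gs] length_gap_word[of gs] count_gap_word[of gs]
    by (auto simp: compositions_def)
next
  fix xs assume xs: "xs \<in> {xs. length xs = m \<and> count_list xs LB = k \<and> hd xs = LB}"
  then obtain gs where gs: "xs = gap_word gs"
    using gap_word_surj by blast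
  then have "length gs = k" and "length gs + sum_list gs = m"
    using xs length_gap_word[of gs] count_gap_word[of gs] by auto
  then have "gs \<in> compositions k (m - k)"
    by (auto simp: compositions_def)
  with gs show "\<exists>gs\<in>compositions k (m - k). xs = gap_word gs"
    by blast
qed

text \<open>
  A word with \<open>k\<close> letters \<open>B\<close> is the sum of \<open>k\<close> copies of itself with coefficient \<open>1 / k\<close>, one for each
  position of a \<open>B\<close>, and the copy for a position is rotated so that it starts there. Every word that
  starts with \<open>B\<close> then arises once for each of the \<open>m\<close> positions.
\<close>

lemma S_poly_cyc_eq_necklaces:
  assumes "0 < k" and "k \<le> m"
  shows "S_poly m k \<simeq> (\<Sum>gs\<in>compositions k (m - k). necklace gs (m / k))"
proof -
  define W where "W = {xs :: letter list. length xs = m \<and> count_list xs LB = k}"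
  define G where "G xs = (if hd xs = LB then word_term xs (1 / k) else 0)" for xs
  have bij: "bij_betw Word W {w. length (letters w) = m \<and> count_list (letters w) LB = k}"
    by (rule bij_betw_byWitness[of _ letters]) (auto simp: W_def)
  have fin: "finite W"
    using bij_betw_finite[OF bij] finite_words_length[of m "\<lambda>w. count_list (letters w) LB = k"]
    by simp
  have rot: "rotate1 xs \<in> W" if "xs \<in> W" for xs
    using that by (cases xs) (auto simp: W_def)
  have spread: "word_term xs 1 \<simeq> (\<Sum>i<m. G (rotate i xs))" if xs: "xs \<in> W" for xs
  proof -
    have len: "length xs = m" and "xs \<noteq> []"
      using xs assms by (auto simp: W_def)
    have "card {i. i < m \<and> xs ! i = LB} = k"
      using xs by (simp add: W_def count_list_eq_length_filter length_filter_conv_card eq_commute)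
    then have "word_term xs 1 = (\<Sum>i | i < m \<and> xs ! i = LB. word_term xs (1 / k))"
      using assms(1) by (simp add: mult_single flip: single_of_nat)
    also have "\<dots> = (\<Sum>i<m. if xs ! i = LB then word_term xs (1 / k) else 0)"
      by (rule sum.mono_neutral_cong_left) auto
    also have "\<dots> \<simeq> (\<Sum>i<m. G (rotate i xs))"
    proof (rule cyc_eq_sum)
      fix i assume "i \<in> {..<m}"
      then have "hd (rotate i xs) = xs ! i"
        using hd_rotate_conv_nth[OF \<open>xs \<noteq> []\<close>, of i] len by simp
      then show "(if xs ! i = LB then word_term xs (1 / k) else 0) \<simeq> G (rotate i xs)"
        by (simp add: G_def cyc_eq_rotate)
    qed
    finally show ?thesis .
  qed
  have "S_poly m k = (\<Sum>xs\<in>W. word_term xs 1)"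
    unfolding S_poly_def by (rule sum.reindex_bij_betw[OF bij, symmetric])
  also have "\<dots> \<simeq> (\<Sum>xs\<in>W. \<Sum>i<m. G (rotate i xs))"
    by (rule cyc_eq_sum) (rule spread)
  also have "\<dots> = (\<Sum>i<m. \<Sum>xs\<in>W. G (rotate i xs))"
    by (rule sum.swap)
  also have "\<dots> = (\<Sum>i<m. \<Sum>xs\<in>W. G xs)"
    by (simp add: sum_rotate[OF fin rot])
  also have "\<dots> = (\<Sum>xs\<in>W. \<Sum>i<m. G xs)"
    by (rule sum.swap)
  also have "\<dots> = (\<Sum>xs | length xs = m \<and> count_list xs LB = k \<and> hd xs = LB.
      word_term xs (m / k))"
    using fin by (intro sum.mono_neutral_cong_right)
      (auto simp: W_def G_def mult_single simp flip: single_of_nat)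
  also have "\<dots> = (\<Sum>gs\<in>compositions k (m - k). necklace gs (m / k))"
    by (rule sum.reindex_bij_betw[OF bij_gap_word[OF assms], symmetric])
  finally show ?thesis .
qed

text \<open>
  Replacing every gap list by each of its \<open>k\<close> rotations with coefficient \<open>1 / k\<close> turns a weight into its
  average over the rotations. So only these averages matter up to cyclic equivalence.
\<close>

lemma weighted_necklaces_cyc_eq:
  assumes "0 < k"
    and "\<And>gs. gs \<in> compositions k N \<Longrightarrow> (\<Sum>i<k. V (rotate i gs)) = (\<Sum>i<k. W (rotate i gs))"
  shows "(\<Sum>gs\<in>compositions k N. necklace gs (V gs)) \<simeq>
    (\<Sum>gs\<in>compositions k N. necklace gs (W gs))"
proof -
  have average: "(\<Sum>gs\<in>compositions k N. necklace gs (V gs)) \<simeq>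
      (\<Sum>gs\<in>compositions k N. necklace gs ((\<Sum>i<k. V (rotate i gs)) / k))" for V
  proof -
    have rot: "rotate1 gs \<in> compositions k N" if "gs \<in> compositions k N" for gs
      using that by (cases gs) (auto simp: compositions_def)
    have "(\<Sum>gs\<in>compositions k N. necklace gs (V gs)) =
        (\<Sum>i<k. \<Sum>gs\<in>compositions k N. necklace gs (V gs / k))"
      using assms(1) by (simp add: mult_single sum_distrib_left flip: single_of_nat)
    also have "\<dots> = (\<Sum>i<k. \<Sum>gs\<in>compositions k N. necklace (rotate i gs) (V (rotate i gs) / k))"
      by (simp add: sum_rotate[OF finite_compositions rot, where G = "\<lambda>gs. necklace gs (V gs / k)"])
    also have "\<dots> \<simeq> (\<Sum>i<k. \<Sum>gs\<in>compositions k N. necklace gs (V (rotate i gs) / k))"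
      by (intro cyc_eq_sum cyc_eq_sym[OF necklace_rotate])
    also have "\<dots> = (\<Sum>gs\<in>compositions k N. \<Sum>i<k. necklace gs (V (rotate i gs) / k))"
      by (rule sum.swap)
    also have "\<dots> = (\<Sum>gs\<in>compositions k N. necklace gs ((\<Sum>i<k. V (rotate i gs)) / k))"
    proof (rule sum.cong)
      fix gs
      have "(\<Sum>i\<in>I. word_term xs (v i)) = word_term xs (sum v I)" for I :: "nat set" and v xs
        by (induction I rule: infinite_finite_induct) (auto simp: single_add)
      then show "(\<Sum>i<k. necklace gs (V (rotate i gs) / k)) =
          necklace gs ((\<Sum>i<k. V (rotate i gs)) / k)"
        by (simp add: sum_divide_distrib)
    qed simp
    finally show ?thesis .
  qed
  have "(\<Sum>gs\<in>compositions k N. necklace gs ((\<Sum>i<k. V (rotate i gs)) / k)) =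
      (\<Sum>gs\<in>compositions k N. necklace gs ((\<Sum>i<k. W (rotate i gs)) / k))"
    using assms(2) by simp
  then show ?thesis
    using cyc_eq_trans[OF average[of V]] cyc_eq_sym[OF average[of W]] by simp
qed

section \<open>Sums of Hermitian squares\<close>

lemma soh_0: "sum_of_hermitian_squares 0"
  unfolding sum_of_hermitian_squares_def by (rule exI[of _ "[]"]) simp

lemma soh_square: "sum_of_hermitian_squares (nc_star f * f)"
  unfolding sum_of_hermitian_squares_def by (rule exI[of _ "[f]"]) simp

lemma soh_add:
  assumes "sum_of_hermitian_squares f" and "sum_of_hermitian_squares g"
  shows "sum_of_hermitian_squares (f + g)"
proof -
  obtain fs gs where "f = (\<Sum>f\<leftarrow>fs. nc_star f * f)" and "g = (\<Sum>f\<leftarrow>gs. nc_star f * f)"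
    using assms unfolding sum_of_hermitian_squares_def by blast
  then have "f + g = (\<Sum>f\<leftarrow>fs @ gs. nc_star f * f)"
    by simp
  then show ?thesis
    unfolding sum_of_hermitian_squares_def by blast
qed

lemma soh_sum:
  assumes "\<And>x. x \<in> X \<Longrightarrow> sum_of_hermitian_squares (f x)"
  shows "sum_of_hermitian_squares (sum f X)"
  using assms by (induction X rule: infinite_finite_induct) (auto intro: soh_add soh_0)

lemma star_word_term_mult:
  "nc_star (word_term xs r) * word_term ys s = word_term (rev xs @ ys) (r * s)"
  by (simp add: nc_star_single word_term_mult)

lemma nc_star_0: "nc_star 0 = 0"
  by (simp add: nc_star_def)

lemma star_sum_mult_sum:
  "nc_star (\<Sum>k\<in>X. f k) * (\<Sum>k\<in>X. f k) = (\<Sum>k\<in>X. \<Sum>k'\<in>X. nc_star (f k) * f k')"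
  by (simp add: nc_star_sum sum_product)

lemma star_add_mult_add:
  "nc_star (f + g) * (f' + g') =
    nc_star f * f' + nc_star f * g' + nc_star g * f' + nc_star g * g'"
  by (simp add: nc_star_add algebra_simps)

lemma star_if_mult_if:
  assumes "P \<Longrightarrow> Q \<Longrightarrow> nc_star f * g \<simeq> h"
  shows "nc_star (if P then f else 0) * (if Q then g else 0) \<simeq> (if P \<and> Q then h else 0)"
  using assms by (simp add: nc_star_0)

section \<open>Two letters \<open>B\<close>\<close>

definition one_B :: "nat \<Rightarrow> nat \<Rightarrow> real \<Rightarrow> nc_poly"
  where "one_B i l c = word_term (replicate i LA @ LB # replicate l LA) c"

lemma one_B_square: "nc_star (one_B i l c) * one_B i' l' c \<simeq> necklace [i + i', l + l'] (c * c)"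
proof -
  have "nc_star (one_B i l c) * one_B i' l' c =
      word_term (replicate l LA @ (LB # replicate (i + i') LA @ LB # replicate l' LA)) (c * c)"
    by (simp add: one_B_def star_word_term_mult replicate_add)
  also have "\<dots> \<simeq>
      word_term ((LB # replicate (i + i') LA @ LB # replicate l' LA) @ replicate l LA) (c * c)"
    by (rule cyc_eq_append_swap)
  also have "\<dots> = necklace [i + i', l + l'] (c * c)"
    by (simp add: add.commute[of l l'] replicate_add)
  finally show ?thesis .
qed

text \<open>
  With \<open>h a = x ^ a\<close> this is \<open>1 + x ^ (2 p) + (\<Sum>j<p. (x ^ j + x ^ (j + 1))\<^sup>2) = (\<Sum>a\<le>2 p. 2 x ^ a)\<close>. Since the
  products of words are known only up to cyclic equivalence, the identity is needed for an arbitrary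
  sequence in place of the powers of \<open>x\<close>.
\<close>

lemma doubled_interval_sum:
  fixes h :: "nat \<Rightarrow> 'a :: comm_monoid_add"
  shows "h 0 + h (2 * p) + (\<Sum>j<p. h (2 * j) + (h (2 * j + 1) + h (2 * j + 1)) + h (2 * j + 2)) =
    (\<Sum>a\<le>2 * p. h a + h a)"
proof (induction p)
  case 0
  then show ?case
    by simp
next
  case (Suc p)
  let ?X = "\<Sum>j<p. h (2 * j) + (h (2 * j + 1) + h (2 * j + 1)) + h (2 * j + 2)"
  have "(\<Sum>a\<le>2 * Suc p. h a + h a) = (\<Sum>a\<le>2 * p. h a + h a) +
      (h (2 * p + 1) + h (2 * p + 1)) + (h (2 * p + 2) + h (2 * p + 2))"
    by simp
  also have "\<dots> = h 0 + h (2 * p) + ?X +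
      (h (2 * p + 1) + h (2 * p + 1)) + (h (2 * p + 2) + h (2 * p + 2))"
    by (simp only: Suc.IH)
  finally show ?case
    by (simp add: ac_simps)
qed

text \<open>
  The squares are those of \<open>v 0\<close>, \<open>v p\<close> and \<open>v j + v (j + 1)\<close>. A factor \<open>w\<close> is built into the words as the
  coefficient \<open>sqrt w\<close>.
\<close>

lemma two_B_necklaces_soh:
  assumes "0 \<le> w"
  shows "\<exists>g. sum_of_hermitian_squares g \<and>
    (\<Sum>gs\<in>compositions 2 (2 * p). necklace gs (2 * w)) \<simeq> g"
proof -
  define v where "v j = one_B j (p - j) (sqrt w)" for j
  define h where "h a = necklace [a, 2 * p - a] w" for a
  define g where "g = nc_star (v 0) * v 0 + nc_star (v p) * v p +
    (\<Sum>j<p. nc_star (v j + v (j + 1)) * (v j + v (j + 1)))"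
  have vv: "nc_star (v i) * v j \<simeq> h a" if "i \<le> p" "j \<le> p" "a = i + j" for i j a
  proof -
    have "(p - i) + (p - j) = 2 * p - (i + j)"
      using that by simp
    then show ?thesis
      using one_B_square[of i "p - i" "sqrt w" j "p - j"] assms that by (simp add: v_def h_def)
  qed
  have "bij_betw (\<lambda>a. [a, 2 * p - a]) {..2 * p} (compositions 2 (2 * p))"
    by (rule bij_betw_byWitness[of _ hd])
      (auto simp: compositions_def length_Suc_conv numeral_2_eq_2)
  then have "(\<Sum>gs\<in>compositions 2 (2 * p). necklace gs (2 * w)) =
      (\<Sum>a\<le>2 * p. necklace [a, 2 * p - a] (2 * w))"
    by (rule sum.reindex_bij_betw[symmetric])
  also have "\<dots> = (\<Sum>a\<le>2 * p. h a + h a)"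
    by (simp add: h_def flip: single_add)
  also have "\<dots> = h 0 + h (2 * p) +
      (\<Sum>j<p. h (2 * j) + (h (2 * j + 1) + h (2 * j + 1)) + h (2 * j + 2))"
    by (rule doubled_interval_sum[symmetric])
  finally have sum_eq: "(\<Sum>gs\<in>compositions 2 (2 * p). necklace gs (2 * w)) = \<dots>" .
  have "nc_star (v j + v (j + 1)) * (v j + v (j + 1)) \<simeq>
      h (2 * j) + (h (2 * j + 1) + h (2 * j + 1)) + h (2 * j + 2)" if "j < p" for j
  proof -
    have "nc_star (v j + v (j + 1)) * (v j + v (j + 1)) = nc_star (v j) * v j +
        (nc_star (v j) * v (j + 1) + nc_star (v (j + 1)) * v j) + nc_star (v (j + 1)) * v (j + 1)"
      by (simp only: star_add_mult_add add.assoc)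
    also have "\<dots> \<simeq> h (2 * j) + (h (2 * j + 1) + h (2 * j + 1)) + h (2 * j + 2)"
      using that by (intro cyc_eq_add vv) auto
    finally show ?thesis .
  qed
  then have "g \<simeq> h 0 + h (2 * p) +
      (\<Sum>j<p. h (2 * j) + (h (2 * j + 1) + h (2 * j + 1)) + h (2 * j + 2))"
    unfolding g_def by (intro cyc_eq_add cyc_eq_sum vv) auto
  then have "(\<Sum>gs\<in>compositions 2 (2 * p). necklace gs (2 * w)) \<simeq> g"
    unfolding sum_eq by (rule cyc_eq_sym)
  moreover have "sum_of_hermitian_squares g"
    unfolding g_def by (intro soh_add soh_sum soh_square)
  ultimately show ?thesis
    by blast
qed

section \<open>Four letters \<open>B\<close>\<close>

definition two_B :: "nat \<Rightarrow> nat \<Rightarrow> nat \<Rightarrow> real \<Rightarrow> nc_poly"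
  where "two_B i j l c =
    word_term (replicate i LA @ LB # replicate j LA @ LB # replicate l LA) c"

lemma two_B_square:
  "nc_star (two_B i j l c) * two_B i' j' l' c \<simeq> necklace [j, i + i', j', l + l'] (c * c)"
proof -
  let ?w = "LB # replicate j LA @ LB # replicate (i + i') LA @ LB # replicate j' LA @
    LB # replicate l' LA"
  have "nc_star (two_B i j l c) * two_B i' j' l' c = word_term (replicate l LA @ ?w) (c * c)"
    by (simp add: two_B_def star_word_term_mult replicate_add)
  also have "\<dots> \<simeq> word_term (?w @ replicate l LA) (c * c)"
    by (rule cyc_eq_append_swap)
  also have "\<dots> = necklace [j, i + i', j', l + l'] (c * c)"
    by (simp add: add.commute[of l l'] replicate_add)
  finally show ?thesis .
qed

text \<open>
  With \<open>h b = x ^ b\<close>, the summand for \<open>r\<close> is \<open>x ^ (2 r) \<phi>\<^sub>r(k) \<phi>\<^sub>r(k')\<close>, where \<open>\<phi>\<^sub>r(k) = [2 r + 1 \<le> k] + x [2 r + 2 \<le> k]\<close>.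
  As long as \<open>2 r + 2 \<le> min k k'\<close> it is \<open>x ^ (2 r) (1 + x)\<^sup>2\<close>, and these summands and the initial \<open>1\<close>
  overlap at the even powers, which gives every power below \<open>min k k'\<close> the coefficient \<open>2\<close>. If \<open>min k k'\<close> is
  odd, one summand is cut off: it is \<open>x ^ (2 r) (1 + x)\<close> for \<open>k \<noteq> k'\<close>, but only \<open>x ^ (2 r)\<close> for \<open>k = k'\<close>.
\<close>

lemma gram_entry_sum:
  fixes h :: "nat \<Rightarrow> 'a :: comm_monoid_add"
  shows "h 0 + (\<Sum>r<R.
      (if 2 * r + 1 \<le> k \<and> 2 * r + 1 \<le> k' then h (2 * r) else 0) +
      (if 2 * r + 1 \<le> k \<and> 2 * r + 2 \<le> k' then h (2 * r + 1) else 0) +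
      (if 2 * r + 2 \<le> k \<and> 2 * r + 1 \<le> k' then h (2 * r + 1) else 0) +
      (if 2 * r + 2 \<le> k \<and> 2 * r + 2 \<le> k' then h (2 * r + 2) else 0)) =
    (\<Sum>b<min (min k k') (2 * R). h b + h b) +
      (if k = k' \<and> odd k \<and> k < 2 * R then 0 else h (min (min k k') (2 * R)))"
    (is "h 0 + (\<Sum>r<R. ?t r) = ?D R + ?e R")
proof -
  define t where "t = ?t"
  have "h 0 + (\<Sum>r<R. t r) = ?D R + ?e R" for R
  proof (induction R)
    case 0
    then show ?case
      by simp
  next
    case (Suc R)
    have split: "h 0 + (\<Sum>r<Suc R. t r) = ?D R + ?e R + t R"
      by (simp only: sum.lessThan_Suc Suc.IH flip: add.assoc)
    consider "min k k' \<le> 2 * R" | "min k k' = 2 * R + 1" "k = k'"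
      | "min k k' = 2 * R + 1" "k \<noteq> k'" | "2 * R + 2 \<le> min k k'"
      by linarith
    then show ?case
    proof cases
      case 1
      then have "k = k' \<and> odd k \<and> k < 2 * R \<longleftrightarrow> k = k' \<and> odd k \<and> k < 2 * Suc R"
        by (cases "k = 2 * R") auto
      moreover have "min (min k k') (2 * R) = min k k'" "min (min k k') (2 * Suc R) = min k k'"
        using 1 by auto
      moreover have "t R = 0"
        using 1 by (auto simp: t_def)
      ultimately show ?thesis
        unfolding split by (simp only: add_0_right)
    next
      case 2
      then have "t R = h (2 * R)"
        by (simp add: t_def)
      with 2 show ?thesis
        unfolding split by (simp add: add.assoc)
    next
      case 3
      then have "t R = h (2 * R) + h (2 * R + 1)"
        by (auto simp: t_def)
      moreover have "min (min k k') (2 * R) = 2 * R" "min (min k k') (2 * Suc R) = Suc (2 * R)"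
        using 3 by auto
      ultimately show ?thesis
        using 3(2) unfolding split by (simp add: add.assoc)
    next
      case 4
      then have "t R = h (2 * R) + h (2 * R + 1) + h (2 * R + 1) + h (2 * R + 2)"
        by (simp add: t_def)
      moreover have "min (min k k') (2 * R) = 2 * R"
          "min (min k k') (2 * Suc R) = Suc (Suc (2 * R))"
        using 4 by auto
      moreover have "\<not> k < 2 * R" "\<not> k < 2 * Suc R"
        using 4 by auto
      ultimately show ?thesis
        unfolding split by (simp add: add.assoc)
    qed
  qed
  then show ?thesis
    by (simp only: t_def)
qed

text \<open>
  The coefficients with which the squares produce the necklaces. They are chosen such that they add up
  to \<open>2\<close> over the four rotations of every list.
\<close>

definition weight :: "nat \<Rightarrow> nat list \<Rightarrow> real"
  where "weight p gs = (let a = gs ! 0; b = gs ! 1; c = gs ! 2 in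
    if a + b < p \<and> b + c < p then 2
    else if a + b = p \<and> b + c = p then of_bool (even b)
    else of_bool (a + b \<le> p \<and> b + c \<le> p))"

text \<open>
  Since \<open>c + d = 2 p - (a + b)\<close> and \<open>d + a = 2 p - (b + c)\<close>, the positions of \<open>a + b\<close> and \<open>b + c\<close> relative to
  \<open>p\<close> determine all four weights, except for the list \<open>[p - b, b, p - b, b]\<close>. There the weights depend on
  the parities of \<open>b\<close> and \<open>p - b\<close>, which differ because \<open>p\<close> is odd.
\<close>

lemma weight_rotations:
  assumes "odd p" and "gs \<in> compositions 4 (2 * p)"
  shows "(\<Sum>i<4. weight p (rotate i gs)) = 2"
proof -
  obtain a b c d where gs: "gs = [a, b, c, d]"
    using assms(2) by (auto simp: compositions_def length_Suc_conv numeral_eq_Suc)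
  have sum: "a + b + c + d = 2 * p"
    using assms(2) by (simp add: compositions_def gs)
  have "(\<Sum>i<4. weight p (rotate i gs)) =
      weight p [a, b, c, d] + weight p [b, c, d, a] + weight p [c, d, a, b] + weight p [d, a, b, c]"
  proof -
    have "(\<Sum>i<4. f i) = f 0 + f 1 + f 2 + f 3" for f :: "nat \<Rightarrow> real"
      by (simp add: eval_nat_numeral)
    moreover have "rotate 2 gs = [c, d, a, b]" "rotate 3 gs = [d, a, b, c]"
      by (simp_all add: gs eval_nat_numeral)
    ultimately show ?thesis
      by (simp add: gs)
  qed
  also have "\<dots> = 2"
  proof (cases "a + b = p \<and> b + c = p")
    case True
    then have "c = a" "d = b" "b + a = p"
      using sum by auto
    moreover have "even a \<longleftrightarrow> odd b"
      using assms(1) \<open>b + a = p\<close> by auto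
    ultimately show ?thesis
      by (simp add: weight_def Let_def add.commute)
  next
    case False
    have cd: "c + d < p \<longleftrightarrow> p < a + b" "c + d = p \<longleftrightarrow> a + b = p" "c + d \<le> p \<longleftrightarrow> p \<le> a + b"
      using sum by auto
    have da: "d + a < p \<longleftrightarrow> p < b + c" "d + a = p \<longleftrightarrow> b + c = p" "d + a \<le> p \<longleftrightarrow> p \<le> b + c"
      using sum by auto
    have "a + b < p \<or> a + b = p \<or> p < a + b" "b + c < p \<or> b + c = p \<or> p < b + c"
      by auto
    then show ?thesis
      using False by (elim disjE) (simp_all add: weight_def Let_def cd da)
  qed
  finally show ?thesis .
qed

text \<open>
  The positions of the Gram matrix and the exponents \<open>b \<le> min k k'\<close> in its entries parametrize the gap
  lists on which the weights live.
\<close>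

lemma sum_gaps_bounded:
  fixes f :: "nat list \<Rightarrow> 'a :: comm_monoid_add"
  assumes "\<And>gs. \<not> (gs ! 0 + gs ! 1 \<le> p \<and> gs ! 1 + gs ! 2 \<le> p) \<Longrightarrow> f gs = 0"
  shows "(\<Sum>k\<le>p. \<Sum>k'\<le>p. \<Sum>b\<le>min k k'. f [p - k, b, p - k', k + k' - b]) =
    (\<Sum>gs\<in>compositions 4 (2 * p). f gs)"
proof -
  let ?X = "{gs \<in> compositions 4 (2 * p). gs ! 0 + gs ! 1 \<le> p \<and> gs ! 1 + gs ! 2 \<le> p}"
  have "(\<Sum>k\<le>p. \<Sum>k'\<le>p. \<Sum>b\<le>min k k'. f [p - k, b, p - k', k + k' - b]) =
      (\<Sum>(k, k', b)\<in>(SIGMA k:{..p}. SIGMA k':{..p}. {..min k k'}). f [p - k, b, p - k', k + k' - b])"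
    by (simp add: sum.Sigma)
  also have "\<dots> = (\<Sum>gs\<in>?X. f gs)"
  proof (rule sum.reindex_bij_witness[of _ "\<lambda>gs. (p - gs ! 0, p - gs ! 2, gs ! 1)"
        "\<lambda>(k, k', b). [p - k, b, p - k', k + k' - b]"])
    fix gs assume gs: "gs \<in> ?X"
    then obtain a b c d where abcd: "gs = [a, b, c, d]"
      by (auto simp: compositions_def length_Suc_conv numeral_eq_Suc)
    have "a + b + c + d = 2 * p" "a + b \<le> p" "b + c \<le> p"
      using gs by (simp_all add: compositions_def abcd)
    then show "(case (p - gs ! 0, p - gs ! 2, gs ! 1) of
          (k, k', b) \<Rightarrow> [p - k, b, p - k', k + k' - b]) = gs"
        and "(p - gs ! 0, p - gs ! 2, gs ! 1) \<in> (SIGMA k:{..p}. SIGMA k':{..p}. {..min k k'})"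
      by (auto simp: abcd)
  qed (auto simp: compositions_def)
  also have "\<dots> = (\<Sum>gs\<in>compositions 4 (2 * p). f gs)"
    using assms by (intro sum.mono_neutral_left) (auto simp: finite_compositions)
  finally show ?thesis .
qed

text \<open>
  The polynomials that are squared are the homogeneous forms of \<open>1\<close> and of the \<open>x ^ r \<phi>\<^sub>r\<close> in the
  decomposition of the Gram matrix: the index \<open>k\<close> stands for the middle exponent \<open>p - k\<close>, and \<open>x ^ i\<close> stands
  for the outer exponents \<open>i\<close> and \<open>k - i\<close>. The average weight of a necklace is \<open>1 / 2\<close>, whence the
  coefficient \<open>w / 2\<close>.
\<close>

lemma four_B_necklaces_soh:
  assumes "odd p" and "0 \<le> w"
  shows "\<exists>g. sum_of_hermitian_squares g \<and>
    (\<Sum>gs\<in>compositions 4 (2 * p). necklace gs (w / 2)) \<simeq> g"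
proof -
  obtain q where q: "p = 2 * q + 1"
    using assms(1) by (elim oddE)
  define T where "T i j l = two_B i j l (sqrt w)" for i j l
  define h where "h k k' b = necklace [p - k, b, p - k', k + k' - b] w" for k k' b
  define F where "F r k = (if 2 * r + 1 \<le> k then T r (p - k) (k - r) else 0) +
    (if 2 * r + 2 \<le> k then T (r + 1) (p - k) (k - r - 1) else 0)" for r k
  define g where "g = nc_star (\<Sum>k\<le>p. T 0 (p - k) k) * (\<Sum>k\<le>p. T 0 (p - k) k) +
    (\<Sum>r<q + 1. nc_star (\<Sum>k\<le>p. F r k) * (\<Sum>k\<le>p. F r k))"
  have TT: "nc_star (T i (p - k) l) * T i' (p - k') l' \<simeq> h k k' b"
    if "b = i + i'" "i + l = k" "i' + l' = k'" for i l i' l' k k' b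
  proof -
    have "l + l' = k + k' - b"
      using that by simp
    then show ?thesis
      using two_B_square[of i "p - k" l "sqrt w" i' "p - k'" l'] assms(2) that
      by (simp add: T_def h_def)
  qed
  define t where "t k k' r =
    (if 2 * r + 1 \<le> k \<and> 2 * r + 1 \<le> k' then h k k' (2 * r) else 0) +
    (if 2 * r + 1 \<le> k \<and> 2 * r + 2 \<le> k' then h k k' (2 * r + 1) else 0) +
    (if 2 * r + 2 \<le> k \<and> 2 * r + 1 \<le> k' then h k k' (2 * r + 1) else 0) +
    (if 2 * r + 2 \<le> k \<and> 2 * r + 2 \<le> k' then h k k' (2 * r + 2) else 0)" for r k k'
  have FF: "nc_star (F r k) * F r k' \<simeq> t k k' r" for r k k'
    unfolding F_def t_def star_add_mult_add
    by (intro cyc_eq_add star_if_mult_if TT) simp_all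
  define f where "f gs = necklace gs (w * weight p gs)" for gs
  have entry: "nc_star (T 0 (p - k) k) * T 0 (p - k') k' + (\<Sum>r<q + 1. nc_star (F r k) * F r k') \<simeq>
      (\<Sum>b\<le>min k k'. f [p - k, b, p - k', k + k' - b])"
    if "k \<le> p" "k' \<le> p" for k k'
  proof -
    let ?E = "nc_star (T 0 (p - k) k) * T 0 (p - k') k' + (\<Sum>r<q + 1. nc_star (F r k) * F r k')"
    let ?W = "\<lambda>b. weight p [p - k, b, p - k', k + k' - b]"
    have "?E \<simeq> h k k' 0 + (\<Sum>r<q + 1. t k k' r)"
      by (rule cyc_eq_add[OF TT cyc_eq_sum[OF FF]]) auto
    also have "\<dots> = (\<Sum>b<min k k'. h k k' b + h k k' b) +
        (if k = k' \<and> odd k then 0 else h k k' (min k k'))"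
    proof -
      \<comment> \<open>As \<open>2 * (q + 1) = p + 1\<close> exceeds every index, no entry is truncated.\<close>
      have "min (min k k') (2 * (q + 1)) = min k k'" "k < 2 * (q + 1)"
        using that q by auto
      then show ?thesis
        by (simp only: t_def gram_entry_sum[of "h k k'"] simp_thms)
    qed
    also have "\<dots> = (\<Sum>b<min k k'. f [p - k, b, p - k', k + k' - b]) +
        f [p - k, min k k', p - k', k + k' - min k k']"
    proof (rule arg_cong2[where f = "(+)"])
      show "(\<Sum>b<min k k'. h k k' b + h k k' b) =
          (\<Sum>b<min k k'. f [p - k, b, p - k', k + k' - b])"
      proof (rule sum.cong)
        fix b assume "b \<in> {..<min k k'}"
        then have "?W b = 2"
          using that by (auto simp: weight_def Let_def)
        then show "h k k' b + h k k' b = f [p - k, b, p - k', k + k' - b]"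
          by (simp add: h_def f_def mult.commute flip: single_add)
      qed simp
      define e where "e = (k = k' \<and> odd k)"
      have "(p - k) + min k k' \<le> p" "min k k' + (p - k') \<le> p"
          "\<not> ((p - k) + min k k' < p \<and> min k k' + (p - k') < p)"
          "(p - k) + min k k' = p \<and> min k k' + (p - k') = p \<longleftrightarrow> k = k'"
        using that by (auto simp: min_def)
      then have W: "?W (min k k') = (if e then 0 else 1)"
        by (simp add: weight_def Let_def e_def)
      show "(if k = k' \<and> odd k then 0 else h k k' (min k k')) =
          f [p - k, min k k', p - k', k + k' - min k k']"
        unfolding f_def W e_def[symmetric] by (simp add: h_def)
    qed
    also have "\<dots> = (\<Sum>b\<le>min k k'. f [p - k, b, p - k', k + k' - b])"
      by (simp flip: lessThan_Suc_atMost)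
    finally show ?thesis .
  qed
  have "g = (\<Sum>k\<le>p. \<Sum>k'\<le>p. nc_star (T 0 (p - k) k) * T 0 (p - k') k') +
      (\<Sum>r<q + 1. \<Sum>k\<le>p. \<Sum>k'\<le>p. nc_star (F r k) * F r k')"
    by (simp only: g_def star_sum_mult_sum)
  also have "(\<Sum>r<q + 1. \<Sum>k\<le>p. \<Sum>k'\<le>p. nc_star (F r k) * F r k') =
      (\<Sum>k\<le>p. \<Sum>r<q + 1. \<Sum>k'\<le>p. nc_star (F r k) * F r k')"
    by (rule sum.swap)
  also have "\<dots> = (\<Sum>k\<le>p. \<Sum>k'\<le>p. \<Sum>r<q + 1. nc_star (F r k) * F r k')"
    by (rule sum.cong[OF refl], rule sum.swap)
  also have "(\<Sum>k\<le>p. \<Sum>k'\<le>p. nc_star (T 0 (p - k) k) * T 0 (p - k') k') + \<dots> =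
      (\<Sum>k\<le>p. \<Sum>k'\<le>p. nc_star (T 0 (p - k) k) * T 0 (p - k') k' +
        (\<Sum>r<q + 1. nc_star (F r k) * F r k'))"
    by (simp only: sum.distrib)
  finally have g_eq: "g = (\<Sum>k\<le>p. \<Sum>k'\<le>p. nc_star (T 0 (p - k) k) * T 0 (p - k') k' +
        (\<Sum>r<q + 1. nc_star (F r k) * F r k'))" .
  have "g \<simeq> (\<Sum>k\<le>p. \<Sum>k'\<le>p. \<Sum>b\<le>min k k'. f [p - k, b, p - k', k + k' - b])"
    unfolding g_eq by (intro cyc_eq_sum[OF cyc_eq_sum] entry) auto
  moreover have "(\<Sum>k\<le>p. \<Sum>k'\<le>p. \<Sum>b\<le>min k k'. f [p - k, b, p - k', k + k' - b]) =
      (\<Sum>gs\<in>compositions 4 (2 * p). f gs)"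
  proof (rule sum_gaps_bounded)
    fix gs :: "nat list" assume "\<not> (gs ! 0 + gs ! 1 \<le> p \<and> gs ! 1 + gs ! 2 \<le> p)"
    then have "weight p gs = 0"
      by (auto simp: weight_def Let_def)
    then show "f gs = 0"
      by (simp add: f_def)
  qed
  ultimately have "g \<simeq> (\<Sum>gs\<in>compositions 4 (2 * p). f gs)"
    by (simp only:)
  moreover have "(\<Sum>gs\<in>compositions 4 (2 * p). f gs) \<simeq>
      (\<Sum>gs\<in>compositions 4 (2 * p). necklace gs (w / 2))"
    unfolding f_def by (rule weighted_necklaces_cyc_eq)
      (simp_all add: weight_rotations[OF assms(1)] flip: sum_distrib_left)
  ultimately have "(\<Sum>gs\<in>compositions 4 (2 * p). necklace gs (w / 2)) \<simeq> g"
    by (rule cyc_eq_sym[OF cyc_eq_trans])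
  moreover have "sum_of_hermitian_squares g"
    unfolding g_def by (intro soh_add soh_sum soh_square)
  ultimately show ?thesis
    by blast
qed

section \<open>Traces\<close>

definition conj_transpose :: "complex^'n^'n \<Rightarrow> complex^'n^'n"
  where "conj_transpose X = (\<chi> i j. cnj (X $ j $ i))"

lemma conj_transpose_mult: "conj_transpose (X ** Y) = conj_transpose Y ** conj_transpose X"
  by (simp add: conj_transpose_def matrix_matrix_mult_def vec_eq_iff mult.commute)

lemma conj_transpose_scaleR: "conj_transpose (r *\<^sub>R X) = r *\<^sub>R conj_transpose X"
  by (simp add: conj_transpose_def vec_eq_iff)

lemma conj_transpose_sum: "conj_transpose (sum f I) = (\<Sum>i\<in>I. conj_transpose (f i))"
  by (simp add: conj_transpose_def vec_eq_iff)

lemma conj_transpose_one: "conj_transpose (mat 1) = mat 1"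
  by (simp add: conj_transpose_def mat_def vec_eq_iff)

lemma trace_conj_transpose_mult_nonneg: "0 \<le> trace (conj_transpose X ** X)"
proof -
  have "0 \<le> cnj z * z" for z :: complex
    by (simp add: less_eq_complex_def)
  then show ?thesis
    by (simp add: trace_def conj_transpose_def matrix_matrix_mult_def sum_nonneg)
qed

lemma word_eval_append: "word_eval A B (xs @ ys) = word_eval A B xs ** word_eval A B ys"
  by (induction xs) (auto simp: matrix_mul_assoc matrix_mul_lid)

lemma word_eval_rev:
  assumes "hermitian_matrix A" and "hermitian_matrix B"
  shows "word_eval A B (rev xs) = conj_transpose (word_eval A B xs)"
proof (induction xs)
  case Nil
  then show ?case
    by (simp add: conj_transpose_one)
next
  case (Cons x xs)
  have "conj_transpose A = A" "conj_transpose B = B"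
    using assms by (simp_all add: hermitian_matrix_def conj_transpose_def)
  with Cons show ?case
    by (auto simp: word_eval_append conj_transpose_mult matrix_mul_rid split: letter.split)
qed

lemma nc_eval_single: "nc_eval A B (word_term xs r) = r *\<^sub>R word_eval A B xs"
  by (simp add: nc_eval_def)

lemma nc_eval_add: "nc_eval A B (f + g) = nc_eval A B f + nc_eval A B g"
  unfolding nc_eval_def by (rule setsum_keys_plus_distrib) (auto simp: scaleR_add_left)

lemma nc_eval_diff: "nc_eval A B (f - g) = nc_eval A B f - nc_eval A B g"
  using nc_eval_add[of A B "f - g" g] by simp

lemma nc_eval_0: "nc_eval A B 0 = 0"
  by (simp add: nc_eval_def)

lemma nc_eval_sum: "nc_eval A B (sum h I) = (\<Sum>i\<in>I. nc_eval A B (h i))"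
  by (induction I rule: infinite_finite_induct) (auto simp: nc_eval_add nc_eval_0)

lemma matrix_add_rdistrib:
  fixes X Y :: "'a :: semiring_1^'n^'m" and Z :: "'a^'l^'n"
  shows "(X + Y) ** Z = X ** Z + Y ** Z"
  by (simp add: vec_eq_iff matrix_matrix_mult_def distrib_right sum.distrib)

lemma nc_eval_mult: "nc_eval A B (f * g) = nc_eval A B f ** nc_eval A B g"
proof -
  have left: "nc_eval A B (word_term xs r * g) = (r *\<^sub>R word_eval A B xs) ** nc_eval A B g" for xs r g
  proof -
    have *: "nc_eval A B (word_term xs r * word_term ys s) =
        (r *\<^sub>R word_eval A B xs) ** nc_eval A B (word_term ys s)" for ys s
      by (simp add: word_term_mult nc_eval_single word_eval_append vec_eq_iff
          matrix_matrix_mult_def scaleR_sum_right ac_simps)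
    have "nc_eval A B (word_term xs r * (\<Sum>w\<in>W. Poly_Mapping.single w (s w))) =
        (r *\<^sub>R word_eval A B xs) ** nc_eval A B (\<Sum>w\<in>W. Poly_Mapping.single w (s w))" for W s
    proof (induction W rule: infinite_finite_induct)
      case (insert w W)
      then show ?case
        using *[of "letters w" "s w"] by (simp add: distrib_left nc_eval_add matrix_add_ldistrib)
    qed (auto simp: nc_eval_0)
    then show ?thesis
      using nc_poly_expand[of g] by metis
  qed
  have "nc_eval A B ((\<Sum>w\<in>W. Poly_Mapping.single w (s w)) * g) =
      nc_eval A B (\<Sum>w\<in>W. Poly_Mapping.single w (s w)) ** nc_eval A B g" for W s
  proof (induction W rule: infinite_finite_induct)
    case (insert w W)
    then show ?case
      using left[of "letters w" "s w" g] nc_eval_single[of A B "letters w" "s w"]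
      by (simp add: distrib_right nc_eval_add matrix_add_rdistrib)
  qed (auto simp: nc_eval_0)
  then show ?thesis
    using nc_poly_expand[of f] by metis
qed

lemma nc_eval_nc_star:
  assumes "hermitian_matrix A" and "hermitian_matrix B"
  shows "nc_eval A B (nc_star f) = conj_transpose (nc_eval A B f)"
proof -
  have "nc_eval A B (Poly_Mapping.single (rev_word w) r) = r *\<^sub>R conj_transpose (word_eval A B (letters w))"
    for w r
    by (cases w) (simp add: nc_eval_single word_eval_rev[OF assms])
  then show ?thesis
    by (simp add: nc_star_def nc_eval_sum nc_eval_def[of A B f] conj_transpose_sum
        conj_transpose_scaleR)
qed

lemma trace_nc_eval_cyc_eq:
  assumes "f \<simeq> g"
  shows "trace (nc_eval A B f) = trace (nc_eval A B g)"
proof -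
  obtain ps where ps: "f - g = (\<Sum>(a, b)\<leftarrow>ps. a * b - b * a)"
    using assms unfolding cyclically_equivalent_def by blast
  have "trace (nc_eval A B (a * b - b * a)) = 0" for a b
    by (simp add: nc_eval_diff nc_eval_mult trace_sub trace_mul_sym[of "nc_eval A B a"])
  then have "trace (nc_eval A B (\<Sum>(a, b)\<leftarrow>ps. a * b - b * a)) = 0"
    by (induction ps) (auto simp: nc_eval_0 nc_eval_add trace_def sum.distrib)
  then show ?thesis
    by (simp add: nc_eval_diff trace_sub flip: ps)
qed

lemma trace_nc_eval_soh_nonneg:
  assumes "sum_of_hermitian_squares g" and "hermitian_matrix A" and "hermitian_matrix B"
  shows "0 \<le> trace (nc_eval A B g)"
proof -
  have "0 \<le> trace (nc_eval A B (\<Sum>f\<leftarrow>fs. nc_star f * f))" for fs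
  proof (induction fs)
    case Nil
    then show ?case
      by (simp add: nc_eval_0 trace_def)
  next
    case (Cons f fs)
    then show ?case
      by (simp add: nc_eval_add trace_add nc_eval_mult nc_eval_nc_star[OF assms(2,3)]
          trace_conj_transpose_mult_nonneg add_nonneg_nonneg)
  qed
  with assms(1) show ?thesis
    unfolding sum_of_hermitian_squares_def by auto
qed

theorem theorem3p7:
  fixes m k :: nat
  assumes "(k = 2 \<and> m \<ge> 2 \<and> even m) \<or> (k = 4 \<and> m \<ge> 6 \<and> even m \<and> \<not> 4 dvd m)"
  shows "(\<exists>g. sum_of_hermitian_squares g \<and> cyclically_equivalent (S_poly m k) g) \<and>
    (\<forall>(A :: complex^'n^'n) B. hermitian_matrix A \<longrightarrow> hermitian_matrix B \<longrightarrow>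
      0 \<le> trace (nc_eval A B (S_poly m k)))"
proof -
  have "0 < k" "k \<le> m"
    using assms by auto
  note S = S_poly_cyc_eq_necklaces[OF this]
  have "\<exists>g. sum_of_hermitian_squares g \<and>
      (\<Sum>gs\<in>compositions k (m - k). necklace gs (m / k)) \<simeq> g"
    using assms
  proof
    assume k: "k = 2 \<and> m \<ge> 2 \<and> even m"
    then have "m - k = 2 * ((m - 2) div 2)"
      by auto
    \<comment> \<open>The coefficient \<open>m / 2\<close> of the necklaces is \<open>2 * w\<close> for \<open>w = m / 4\<close>.\<close>
    then show ?thesis
      using two_B_necklaces_soh[of "m / 4" "(m - 2) div 2"] k by simp
  next
    assume k: "k = 4 \<and> m \<ge> 6 \<and> even m \<and> \<not> 4 dvd m"
    then have "m - k = 2 * ((m - 4) div 2)" "odd ((m - 4) div 2)"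
      by (auto; presburger)+
    \<comment> \<open>The coefficient \<open>m / 4\<close> of the necklaces is \<open>w / 2\<close> for \<open>w = m / 2\<close>.\<close>
    then show ?thesis
      using four_B_necklaces_soh[of "(m - 4) div 2" "m / 2"] k by simp
  qed
  then obtain g where g: "sum_of_hermitian_squares g" "S_poly m k \<simeq> g"
    using S cyc_eq_trans by blast
  then have "0 \<le> trace (nc_eval A B (S_poly m k))"
    if "hermitian_matrix A" "hermitian_matrix B" for A B :: "complex^'n^'n"
    using trace_nc_eval_soh_nonneg[OF g(1) that] by (simp add: trace_nc_eval_cyc_eq[OF g(2)])
  with g show ?thesis
    by blast
qed

end
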